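(* We have $$C_{1324,3412}(x)=\left(\sum_{k\ge 0}a(k)x^k\right)^2,$$ where $a(k)$ is the $k$-th entry of OEIS sequence A005576, i.e. $a(k)=c\left(\tfrac{r(r+1)}{2}-k,\,r\right)$ for all sufficiently large $r$, with $c(N,r)$ the number of convex penny arrangements of $N$ pennies with $r$ pennies in the bottom row.
   Context: A penny arrangement is a configuration of pennies in rows in the plane such that the bottom row is contiguous and each penny in a higher row touches two pennies in the row below it; it is convex if every row is contiguous. Concretely, with $r$ pennies in the bottom row, number the possible positions in row $h$ ($h=0$ is the bottom row, $0\le h\le r-1$) by $1,\dots,r-h$; a penny arrangement is a choice of a set of occupied positions in each row such that row $0$ is fully occupied and, whenever position $j$ in row $h+1$ is occupied, positions $j$ and $j+1$ in row $h$ are occupied. It is convex if the occupied positions in each row form a (possibly empty) interval of consecutive integers. $c(N,r)$ is the number of convex penny arrangements with $N$ pennies in total and $r$ in the bottom row. For fixed $k$ the value $c(r(r+1)/2-k,r)$ is constant for large $r$; this constant is $a(k)$ (the sequence begins $1,1,2,3,4,7,9,13,17,25,\dots$). $\mathrm{av}_n^k(B)$ is the number of permutations in $S_n$ with exactly $k$ inversions (pairs $i<j$ with $\pi_i>\pi_j$) that avoid every pattern in $B$; a permutation avoids a pattern $q$ if it has no subsequence order-isomorphic to $q$. If for every $k\ge0$ there are constants $m_k,c_k(B)$ with $\mathrm{av}_n^k(B)=c_k(B)$ for all $n\ge m_k$, then $(c_k(B))_{k\ge0}$ is the limit sequence of $B$ and $C_B(x)=\sum_{k\ge 0}c_k(B)x^k$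 is its limit generating function; here $B=\{1324,3412\}$. *)

theory Defs
  imports
    "HOL-Library.Sublist"
    "HOL-Combinatorics.Multiset_Permutations"
    "HOL-Computational_Algebra.Formal_Power_Series"
begin

text \<open>
  Permutations in \<open>S\<^sub>n\<close> are lists in one-line notation, i.e. elements of
  \<^term>\<open>permutations_of_set {1..n}\<close>; patterns are lists in the same notation.
\<close>

definition order_isomorphic :: "nat list \<Rightarrow> nat list \<Rightarrow> bool" where
  "order_isomorphic xs ys \<longleftrightarrow>
     length xs = length ys \<and>
     (\<forall>i < length xs. \<forall>j < length xs. xs ! i < xs ! j \<longleftrightarrow> ys ! i < ys ! j)"

definition avoids :: "nat list \<Rightarrow> nat list \<Rightarrow> bool" where
  "avoids p q \<longleftrightarrow> \<not> (\<exists>s. subseq s p \<and> order_isomorphic s q)"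

definition inversions :: "nat list \<Rightarrow> (nat \<times> nat) set" where
  "inversions p = {(i, j). i < j \<and> j < length p \<and> p ! i > p ! j}"

definition av :: "nat \<Rightarrow> nat \<Rightarrow> nat list set \<Rightarrow> nat" where
  "av n k B =
     card {p \<in> permutations_of_set {1..n}. card (inversions p) = k \<and> (\<forall>q\<in>B. avoids p q)}"

definition eventually_constant :: "(nat \<Rightarrow> nat) \<Rightarrow> bool" where
  "eventually_constant f \<longleftrightarrow> (\<exists>c m. \<forall>n\<ge>m. f n = c)"

text \<open>Meaningful only for eventually constant sequences, for which the value is unique.\<close>

definition eventual_value :: "(nat \<Rightarrow> nat) \<Rightarrow> nat" where
  "eventual_value f = (THE c. \<exists>m. \<forall>n\<ge>m. f n = c)"

definition has_limit_sequence :: "nat list set \<Rightarrow> bool" where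
  "has_limit_sequence B \<longleftrightarrow> (\<forall>k. eventually_constant (\<lambda>n. av n k B))"

definition limit_sequence :: "nat list set \<Rightarrow> nat \<Rightarrow> nat" where
  "limit_sequence B k = eventual_value (\<lambda>n. av n k B)"

definition limit_gf :: "nat list set \<Rightarrow> int fps" where
  "limit_gf B = Abs_fps (\<lambda>k. int (limit_sequence B k))"

text \<open>
  \<open>P h\<close> is the set of occupied positions in row \<open>h\<close>. For \<open>h \<ge> r\<close> the interval
  \<^term>\<open>{1..r - h}\<close> of natural numbers is empty, so there are no pennies in such rows.
\<close>

definition penny_arrangement :: "nat \<Rightarrow> (nat \<Rightarrow> nat set) \<Rightarrow> bool" where
  "penny_arrangement r P \<longleftrightarrow>
     (\<forall>h. P h \<subseteq> {1..r - h}) \<and>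
     P 0 = {1..r} \<and>
     (\<forall>h j. j \<in> P (Suc h) \<longrightarrow> j \<in> P h \<and> j + 1 \<in> P h)"

definition convex_arrangement :: "(nat \<Rightarrow> nat set) \<Rightarrow> bool" where
  "convex_arrangement P \<longleftrightarrow> (\<forall>h. \<exists>a b. P h = {a..b})"

definition convex_penny_count :: "nat \<Rightarrow> nat \<Rightarrow> nat" where
  "convex_penny_count N r =
     card {P. penny_arrangement r P \<and> convex_arrangement P \<and> (\<Sum>h<r. card (P h)) = N}"

text \<open>
  The truncated subtraction only affects the finitely many \<open>r\<close> with \<open>r(r+1)/2 < k\<close>, hence
  not the eventual value.
\<close>

definition convex_penny_defect_count :: "nat \<Rightarrow> nat \<Rightarrow> nat" where
  "convex_penny_defect_count k r = convex_penny_count (r * (r + 1) div 2 - k) r"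

definition A005576 :: "nat \<Rightarrow> nat" where
  "A005576 k = eventual_value (convex_penny_defect_count k)"

end

theory Submission imports Defs
begin

text \<open>
  A permutation avoids 132 iff its Lehmer code \<open>c\<close> is weakly decreasing, and then it avoids 3412
  iff no flat step \<open>c a = c (a + 1)\<close> precedes a drop \<open>c b \<ge> c (b + 1) + 2\<close>. Writing
  \<open>f i = c i + i\<close>, this says that no ascent of \<open>f\<close> precedes a descent. The pennies missing from an
  arrangement also form a Young diagram \<open>c\<close>; the occupied positions of a row are a sublevel set of
  \<open>f\<close>, so convexity is the same condition on \<open>c\<close>. Hence \<open>a(k)\<close> counts the permutations avoiding
  132 and 3412 with \<open>k\<close> inversions in \<open>S\<^sub>n\<close> for \<open>n > k\<close>.

  A long permutation with few inversions preserves many prefixes \<open>{1..t}\<close>. If it avoids 1324, it is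
  the identity between the first and the last of these, so it splits in the middle as a direct
  sum; the left summand avoids 132, the right one avoids 213, and reverse-complementation turns
  the latter into a permutation avoiding 132. This yields the square.
\<close>

section \<open>Pattern containment by positions\<close>

lemma subseq_Cons_iff_nth:
  "subseq (x # xs) ys \<longleftrightarrow> (\<exists>i < length ys. ys ! i = x \<and> subseq xs (drop (Suc i) ys))"
proof
  assume "subseq (x # xs) ys"
  then obtain us v vs where "ys = us @ v # vs" "x = v" "subseq xs vs"
    by (auto dest!: list_emb_ConsD)
  then show "\<exists>i < length ys. ys ! i = x \<and> subseq xs (drop (Suc i) ys)"
    by (intro exI[of _ "length us"]) auto
next
  assume "\<exists>i < length ys. ys ! i = x \<and> subseq xs (drop (Suc i) ys)"
  then obtain i where i: "i < length ys" "ys ! i = x" "subseq xs (drop (Suc i) ys)" by auto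
  then have "subseq (x # xs) (drop i ys)"
    by (metis Cons_nth_drop_Suc subseq_Cons2_iff)
  then show "subseq (x # xs) ys"
    by (metis append_take_drop_id list_emb_append2)
qed

lemma subseq3_iff_nth:
  "subseq [x, y, z] ys \<longleftrightarrow>
     (\<exists>a b c. a < b \<and> b < c \<and> c < length ys \<and> ys ! a = x \<and> ys ! b = y \<and> ys ! c = z)"
  (is "?L \<longleftrightarrow> ?R")
proof
  assume ?L
  then obtain i j k where "i < length ys" "ys ! i = x"
    "j < length ys - Suc i" "ys ! (Suc i + j) = y"
    "k < length ys - Suc i - Suc j" "ys ! (Suc i + (Suc j + k)) = z"
    unfolding subseq_Cons_iff_nth
    by (auto simp: add.commute add.left_commute)
  then show ?R
    by (intro exI[of _ i] exI[of _ "Suc i + j"] exI[of _ "Suc i + (Suc j + k)"]) auto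
next
  assume ?R
  then obtain a b c where "a < b" "b < c" "c < length ys" "ys ! a = x" "ys ! b = y" "ys ! c = z"
    by blast
  then show ?L
    unfolding subseq_Cons_iff_nth
    by (intro exI[of _ a] exI[of _ "b - Suc a"] exI[of _ "c - Suc b"] conjI) auto
qed

lemma subseq4_iff_nth:
  "subseq [w, x, y, z] ys \<longleftrightarrow>
     (\<exists>a b c d. a < b \<and> b < c \<and> c < d \<and> d < length ys \<and>
        ys ! a = w \<and> ys ! b = x \<and> ys ! c = y \<and> ys ! d = z)"
  (is "?L \<longleftrightarrow> ?R")
proof
  assume ?L
  then obtain i a b c where "i < length ys" "ys ! i = w" "a < b" "b < c"
    "c < length (drop (Suc i) ys)" "drop (Suc i) ys ! a = x" "drop (Suc i) ys ! b = y"
    "drop (Suc i) ys ! c = z"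
    unfolding subseq_Cons_iff_nth[of w] subseq3_iff_nth by blast
  then show ?R
    by (intro exI[of _ i] exI[of _ "Suc i + a"] exI[of _ "Suc i + b"] exI[of _ "Suc i + c"]) auto
next
  assume ?R
  then obtain a b c d where *: "a < b" "b < c" "c < d" "d < length ys"
    "ys ! a = w" "ys ! b = x" "ys ! c = y" "ys ! d = z"
    by blast
  then have "subseq [x, y, z] (drop (Suc a) ys)"
    unfolding subseq3_iff_nth
    by (intro exI[of _ "b - Suc a"] exI[of _ "c - Suc a"] exI[of _ "d - Suc a"]) auto
  with * show ?L
    unfolding subseq_Cons_iff_nth[of w] by (intro exI[of _ a]) auto
qed

lemma avoids3_iff:
  assumes "length q = 3"
  shows "avoids p q \<longleftrightarrow> \<not> (\<exists>a b c. a < b \<and> b < c \<and> c < length p \<and>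
    order_isomorphic [p ! a, p ! b, p ! c] q)" (is "_ \<longleftrightarrow> \<not> ?R")
proof -
  have "(\<exists>s. subseq s p \<and> order_isomorphic s q) \<longleftrightarrow> ?R"
  proof
    assume "\<exists>s. subseq s p \<and> order_isomorphic s q"
    then obtain s where s: "subseq s p" "order_isomorphic s q" by blast
    then have "length s = 3" using assms by (simp add: order_isomorphic_def)
    then obtain x y z where [simp]: "s = [x, y, z]"
      by (auto simp: eval_nat_numeral length_Suc_conv)
    from s show ?R by (auto simp: subseq3_iff_nth)
  qed (blast intro: subseq3_iff_nth[THEN iffD2])
  then show ?thesis by (simp add: avoids_def)
qed

lemma avoids4_iff:
  assumes "length q = 4"
  shows "avoids p q \<longleftrightarrow> \<not> (\<exists>a b c d. a < b \<and> b < c \<and> c < d \<and> d < length p \<and>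
    order_isomorphic [p ! a, p ! b, p ! c, p ! d] q)" (is "_ \<longleftrightarrow> \<not> ?R")
proof -
  have "(\<exists>s. subseq s p \<and> order_isomorphic s q) \<longleftrightarrow> ?R"
  proof
    assume "\<exists>s. subseq s p \<and> order_isomorphic s q"
    then obtain s where s: "subseq s p" "order_isomorphic s q" by blast
    then have "length s = 4" using assms by (simp add: order_isomorphic_def)
    then obtain w x y z where [simp]: "s = [w, x, y, z]"
      by (auto simp: eval_nat_numeral length_Suc_conv)
    from s show ?R by (auto simp: subseq4_iff_nth)
  qed (blast intro: subseq4_iff_nth[THEN iffD2])
  then show ?thesis by (simp add: avoids_def)
qed

lemma avoids_132_iff:
  "avoids p [1, 3, 2] \<longleftrightarrow>
     \<not> (\<exists>a b c. a < b \<and> b < c \<and> c < length p \<and> p ! a < p ! c \<and> p ! c < p ! b)"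
proof -
  have "order_isomorphic [x, y, z] [1, 3, 2] \<longleftrightarrow> x < z \<and> z < y" for x y z
    by (auto simp: order_isomorphic_def All_less_Suc)
  then show ?thesis by (simp add: avoids3_iff)
qed

lemma avoids_213_iff:
  "avoids p [2, 1, 3] \<longleftrightarrow>
     \<not> (\<exists>a b c. a < b \<and> b < c \<and> c < length p \<and> p ! b < p ! a \<and> p ! a < p ! c)"
proof -
  have "order_isomorphic [x, y, z] [2, 1, 3] \<longleftrightarrow> y < x \<and> x < z" for x y z
    by (auto simp: order_isomorphic_def All_less_Suc)
  then show ?thesis by (simp add: avoids3_iff)
qed

lemma avoids_1324_iff:
  "avoids p [1, 3, 2, 4] \<longleftrightarrow>
     \<not> (\<exists>a b c d. a < b \<and> b < c \<and> c < d \<and> d < length p \<and>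
          p ! a < p ! c \<and> p ! c < p ! b \<and> p ! b < p ! d)"
proof -
  have "order_isomorphic [w, x, y, z] [1, 3, 2, 4] \<longleftrightarrow> w < y \<and> y < x \<and> x < z" for w x y z
    by (auto simp: order_isomorphic_def All_less_Suc)
  then show ?thesis by (simp add: avoids4_iff)
qed

lemma avoids_3412_iff:
  "avoids p [3, 4, 1, 2] \<longleftrightarrow>
     \<not> (\<exists>a b c d. a < b \<and> b < c \<and> c < d \<and> d < length p \<and>
          p ! c < p ! d \<and> p ! d < p ! a \<and> p ! a < p ! b)"
proof -
  have "order_isomorphic [w, x, y, z] [3, 4, 1, 2] \<longleftrightarrow> y < z \<and> z < w \<and> w < x" for w x y z
    by (auto simp: order_isomorphic_def All_less_Suc)
  then show ?thesis by (simp add: avoids4_iff)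
qed

section \<open>Lehmer codes\<close>

text \<open>A discrete intermediate value argument: with no ascending step \<open>f\<close> would be
  weakly decreasing from \<open>x\<close> to \<open>y\<close>. Applied to a code plus the index it
  yields flat steps; applied to a 0/1 indicator it finds the adjacent positions where a threshold is
  crossed.\<close>

lemma ex_step_up:
  fixes f :: "nat \<Rightarrow> nat"
  assumes "x < y" "f x < f y"
  shows "\<exists>a. x \<le> a \<and> a < y \<and> f a < f (Suc a)"
proof (rule ccontr)
  assume no: "\<nexists>a. x \<le> a \<and> a < y \<and> f a < f (Suc a)"
  have "z \<le> y \<longrightarrow> f z \<le> f x" if "x \<le> z" for z
    using that no by (induction z rule: dec_induct) (auto simp: not_less intro: le_trans)
  with assms show False by (meson less_imp_le not_less order_refl)
qed

lemma ex_step_down: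
  fixes f :: "nat \<Rightarrow> nat"
  assumes "x < y" "f y < f x"
  shows "\<exists>a. x \<le> a \<and> a < y \<and> f (Suc a) < f a"
proof (rule ccontr)
  assume no: "\<nexists>a. x \<le> a \<and> a < y \<and> f (Suc a) < f a"
  have "z \<le> y \<longrightarrow> f x \<le> f z" if "x \<le> z" for z
    using that no by (induction z rule: dec_induct) (auto simp: not_less intro: le_trans)
  with assms show False by (meson less_imp_le not_less order_refl)
qed

text \<open>Total on the naturals: the value is 0 from the last position on, so conditions on codes
  can be quantified over all indices without range guards.\<close>

definition lehmer :: "nat list \<Rightarrow> nat \<Rightarrow> nat" where
  "lehmer p i = card {j. i < j \<and> j < length p \<and> p ! j < p ! i}"

lemma lehmer_le: "lehmer p i \<le> length p - 1 - i"
proof -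
  have "lehmer p i \<le> card {i<..<length p}"
    unfolding lehmer_def by (intro card_mono) auto
  then show ?thesis by simp
qed

lemma card_inversions: "card (inversions p) = (\<Sum>i<length p. lehmer p i)"
proof -
  have "inversions p = (SIGMA i:{..<length p}. {j. i < j \<and> j < length p \<and> p ! j < p ! i})"
    by (auto simp: inversions_def)
  then show ?thesis by (simp add: lehmer_def)
qed

lemma lehmer_Cons_Suc: "lehmer (x # xs) (Suc i) = lehmer xs i"
proof -
  have "{j. Suc i < j \<and> j < length (x # xs) \<and> (x # xs) ! j < (x # xs) ! Suc i} =
    Suc ` {j. i < j \<and> j < length xs \<and> xs ! j < xs ! i}" (is "?A = ?B")
  proof
    show "?A \<subseteq> ?B"
    proof
      fix j assume "j \<in> ?A"
      then show "j \<in> ?B" by (cases j) auto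
    qed
  qed auto
  then show ?thesis by (simp add: lehmer_def card_image)
qed

text \<open>Distinctness lets positions be traded for values: the first code entry is the rank of
  the head among the values and ignores the order of the tail.\<close>

lemma lehmer_Cons_0:
  assumes "distinct xs"
  shows "lehmer (x # xs) 0 = card {y \<in> set xs. y < x}"
proof -
  have "bij_betw (\<lambda>j. xs ! (j - 1)) {j. 0 < j \<and> j < length (x # xs) \<and> (x # xs) ! j < (x # xs) ! 0}
    {y \<in> set xs. y < x}"
  proof (rule bij_betw_imageI)
    show "inj_on (\<lambda>j. xs ! (j - 1)) {j. 0 < j \<and> j < length (x # xs) \<and> (x # xs) ! j < (x # xs) ! 0}"
      using assms by (auto simp: inj_on_def nth_eq_iff_index_eq)
    show "(\<lambda>j. xs ! (j - 1)) ` {j. 0 < j \<and> j < length (x # xs) \<and> (x # xs) ! j < (x # xs) ! 0} =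
      {y \<in> set xs. y < x}"
    proof (intro equalityI subsetI)
      fix y assume "y \<in> {y \<in> set xs. y < x}"
      then obtain i where "i < length xs" "y = xs ! i" "xs ! i < x"
        by (auto simp: in_set_conv_nth)
      then show "y \<in> (\<lambda>j. xs ! (j - 1)) ` {j. 0 < j \<and> j < length (x # xs) \<and> (x # xs) ! j < (x # xs) ! 0}"
        by (intro image_eqI[of _ _ "Suc i"]) auto
    qed (auto simp: nth_Cons')
  qed
  then show ?thesis unfolding lehmer_def by (rule bij_betw_same_card)
qed

text \<open>The rank is strictly increasing in \<open>x\<close>, hence injective, and its
  \<open>card A\<close> values all lie below \<open>card A\<close>. Thus each admissible first code
  entry picks out exactly one head.\<close>

lemma bij_betw_rank:
  fixes A :: "'a::linorder set"
  assumes "finite A"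
  shows "bij_betw (\<lambda>x. card {y \<in> A. y < x}) A {..<card A}"
proof -
  have less: "card {y \<in> A. y < x} < card {y \<in> A. y < x'}" if "x \<in> A" "x < x'" for x x'
    using assms that by (intro psubset_card_mono) auto
  then have inj: "inj_on (\<lambda>x. card {y \<in> A. y < x}) A"
    by (intro linorder_inj_onI') (force dest: less)
  have "card {y \<in> A. y < x} < card A" if "x \<in> A" for x
    using assms that by (intro psubset_card_mono) auto
  then have "(\<lambda>x. card {y \<in> A. y < x}) ` A = {..<card A}"
    using assms inj by (intro card_subset_eq) (auto simp: card_image)
  with inj show ?thesis by (simp add: bij_betw_def)
qed

text \<open>Decoding from the front: the first entry determines the head by its rank, and the
  shifted code determines the tail. Removing the head leaves a general finite set, hence
  \<open>A\<close> instead of \<open>{1..n}\<close>.\<close>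

lemma inj_on_lehmer:
  assumes "finite A"
  shows "inj_on lehmer (permutations_of_set A)"
proof -
  have "p = q" if "p \<in> permutations_of_set A" "q \<in> permutations_of_set A" "lehmer p = lehmer q"
    for p q using assms that
  proof (induction p arbitrary: q A)
    case Nil
    then show ?case by (simp add: permutations_of_set_def)
  next
    case (Cons x xs)
    then obtain y ys where q: "q = y # ys" by (cases q) (auto simp: permutations_of_set_def)
    have mem: "x \<in> A" "y \<in> A" "distinct xs" "distinct ys" "set xs = A - {x}" "set ys = A - {y}"
      using Cons.prems q by (auto simp: permutations_of_set_def)
    have "card {z \<in> A. z < x} = card {z \<in> A. z < y}"
    proof -
      have "{z \<in> set xs. z < x} = {z \<in> A. z < x}" "{z \<in> set ys. z < y} = {z \<in> A. z < y}"
        using mem by auto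
      then show ?thesis
        using Cons.prems q mem by (metis lehmer_Cons_0)
    qed
    then have [simp]: "x = y"
      using bij_betw_rank[OF \<open>finite A\<close>] mem by (auto simp: bij_betw_def inj_on_def)
    have "lehmer xs = lehmer ys"
      using Cons.prems q by (metis lehmer_Cons_Suc ext)
    then have "xs = ys"
      using Cons.IH[of "A - {x}" ys] Cons.prems mem by (auto simp: permutations_of_set_def)
    then show ?case using q by simp
  qed
  then show ?thesis by (auto simp: inj_on_def)
qed

text \<open>The same decoding used as a construction: choose the head of rank \<open>c 0\<close>,
  then realise the shifted code on the remaining values.\<close>

lemma lehmer_surj:
  assumes "finite A" "\<And>i. c i \<le> card A - 1 - i"
  shows "\<exists>p \<in> permutations_of_set A. lehmer p = c"
  using assms
proof (induction "card A" arbitrary: A c)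
  case 0
  \<comment> \<open>With \<open>A\<close> empty the truncated bound is 0, so \<open>c\<close>
    vanishes everywhere.\<close>
  then have "lehmer [] = c" by (intro ext) (simp add: lehmer_def)
  with 0 show ?case by (auto simp: permutations_of_set_def)
next
  case (Suc n)
  have "c 0 < card A" using Suc.prems(2)[of 0] Suc.hyps(2) by simp
  then have "c 0 \<in> (\<lambda>x. card {y \<in> A. y < x}) ` A"
    using bij_betw_imp_surj_on[OF bij_betw_rank[OF \<open>finite A\<close>]] by simp
  then obtain x where x: "x \<in> A" "card {y \<in> A. y < x} = c 0" by auto
  have cardA: "card (A - {x}) = n" using Suc x by simp
  have "c (Suc i) \<le> card (A - {x}) - 1 - i" for i
    using Suc.prems(2)[of "Suc i"] cardA Suc.hyps(2) by simp
  then obtain p where p: "p \<in> permutations_of_set (A - {x})" "lehmer p = (\<lambda>i. c (Suc i))"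
    using Suc.hyps(1)[of "A - {x}" "\<lambda>i. c (Suc i)"] cardA Suc.prems by auto
  have "lehmer (x # p) i = c i" for i
  proof (cases i)
    case 0
    have "{y \<in> set p. y < x} = {y \<in> A. y < x}" using p by (auto simp: permutations_of_set_def)
    then show ?thesis
      using 0 x p by (simp add: lehmer_Cons_0 permutations_of_set_def)
  next
    case (Suc j)
    then show ?thesis using p by (simp add: lehmer_Cons_Suc)
  qed
  moreover have "x # p \<in> permutations_of_set A"
    using p x by (auto simp: permutations_of_set_def)
  ultimately show ?case by (intro bexI[of _ "x # p"]) auto
qed

text \<open>If 132 is avoided, a later entry below \<open>p ! Suc i\<close> is also below
  \<open>p ! i\<close>, for otherwise it would complete a 132 with these two; so the counted sets
  are nested. Conversely, a 132 at \<open>a\<close>, \<open>b\<close>, \<open>c\<close> can be moved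
  to an adjacent ascent across the value \<open>p ! c\<close>, and there the code increases.\<close>

lemma avoids_132_iff_lehmer:
  assumes "distinct p"
  shows "avoids p [1, 3, 2] \<longleftrightarrow> (\<forall>i. lehmer p (Suc i) \<le> lehmer p i)"
proof
  assume av: "avoids p [1, 3, 2]"
  show "\<forall>i. lehmer p (Suc i) \<le> lehmer p i"
  proof
    fix i
    have "p ! j < p ! i" if "Suc i < j" "j < length p" "p ! j < p ! Suc i" for j
    proof (rule ccontr)
      assume "\<not> p ! j < p ! i"
      with assms that have "p ! i < p ! j"
        by (metis Suc_lessD nth_eq_iff_index_eq linorder_neqE_nat less_trans less_irrefl_nat)
      with that av show False unfolding avoids_132_iff by blast
    qed
    then show "lehmer p (Suc i) \<le> lehmer p i"
      unfolding lehmer_def by (intro card_mono) auto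
  qed
next
  assume dec: "\<forall>i. lehmer p (Suc i) \<le> lehmer p i"
  show "avoids p [1, 3, 2]"
  proof (rule ccontr)
    assume "\<not> avoids p [1, 3, 2]"
    then obtain a b c where abc: "a < b" "b < c" "c < length p" "p ! a < p ! c" "p ! c < p ! b"
      unfolding avoids_132_iff by blast
    \<comment> \<open>The indicator of lying at or above the threshold \<open>p ! c\<close>; it
      rises between \<open>a\<close> and \<open>b\<close>, and a rising step is an adjacent
      crossing.\<close>
    define f where "f i = (if p ! i < p ! c then 0 else 1 :: nat)" for i
    have "f a < f b" using abc by (simp add: f_def)
    from ex_step_up[OF \<open>a < b\<close> this]
    obtain w where w: "w < b" "p ! w < p ! c" "\<not> p ! Suc w < p ! c"
      by (auto simp: f_def split: if_splits)
    moreover have "p ! c \<noteq> p ! Suc w"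
      using assms abc w by (auto simp: nth_eq_iff_index_eq)
    ultimately have cw: "p ! c < p ! Suc w" by simp
    \<comment> \<open>Everything counted at \<open>w\<close> is counted at \<open>Suc w\<close>, and
      position \<open>c\<close> is counted only at \<open>Suc w\<close>.\<close>
    have "lehmer p w < lehmer p (Suc w)"
      unfolding lehmer_def
    proof (rule psubset_card_mono)
      have "Suc w < j" if "w < j" "p ! j < p ! w" for j
        using that cw w by (cases "j = Suc w") auto
      then have "{j. w < j \<and> j < length p \<and> p ! j < p ! w} \<subseteq>
        {j. Suc w < j \<and> j < length p \<and> p ! j < p ! Suc w}"
        using w cw by force
      moreover have "c \<in> {j. Suc w < j \<and> j < length p \<and> p ! j < p ! Suc w}"
        "c \<notin> {j. w < j \<and> j < length p \<and> p ! j < p ! w}"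
        using w cw abc by auto
      ultimately show "{j. w < j \<and> j < length p \<and> p ! j < p ! w} \<subset>
        {j. Suc w < j \<and> j < length p \<and> p ! j < p ! Suc w}"
        by blast
    qed auto
    with dec show False by (meson not_less)
  qed
qed

section \<open>Codes of permutations that avoid 3412 as well\<close>

text \<open>With \<open>f i = c i + i\<close> the two inequalities say
  \<open>f a < f (Suc a)\<close> and \<open>f (Suc b) < f b\<close>. For a weakly decreasing
  \<open>c\<close> the first one amounts to equality of the two entries.\<close>

definition flat_before_cliff :: "(nat \<Rightarrow> nat) \<Rightarrow> bool" where
  "flat_before_cliff c \<longleftrightarrow> (\<exists>a b. a < b \<and> c a \<le> c (Suc a) \<and> c (Suc b) + 2 \<le> c b)"

text \<open>An inversion starting at \<open>x\<close> ends strictly between \<open>x\<close> and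
  \<open>y\<close>, or it ends beyond \<open>y\<close> and then gives an inversion starting at
  \<open>y\<close>, because \<open>p ! x < p ! y\<close>. Hence code plus index grows from
  \<open>x\<close> to \<open>y\<close> and must ascend at some step.\<close>

lemma lehmer_flat:
  assumes "distinct p" "avoids p [1, 3, 2]" "x < y" "y < length p" "p ! x < p ! y"
  shows "\<exists>a. x \<le> a \<and> a < y \<and> lehmer p a \<le> lehmer p (Suc a)"
proof -
  have "p ! j < p ! x" if "y < j" "j < length p" "p ! j < p ! y" for j
  proof (rule ccontr)
    assume "\<not> p ! j < p ! x"
    moreover have "p ! j \<noteq> p ! x" using assms that by (simp add: nth_eq_iff_index_eq)
    ultimately have "p ! x < p ! j" by simp
    with that assms show False unfolding avoids_132_iff by blast
  qed
  then have "{j. x < j \<and> j < length p \<and> p ! j < p ! x} \<subseteq>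
      {x<..<y} \<union> {j. y < j \<and> j < length p \<and> p ! j < p ! y}"
    using assms by (auto simp: not_less_iff_gr_or_eq)
  then have "lehmer p x \<le> card ({x<..<y} \<union> {j. y < j \<and> j < length p \<and> p ! j < p ! y})"
    unfolding lehmer_def by (intro card_mono) auto
  also have "\<dots> \<le> card {x<..<y} + lehmer p y"
    unfolding lehmer_def by (rule card_Un_le)
  finally have "lehmer p x + x < lehmer p y + y" using assms by simp
  from ex_step_up[OF \<open>x < y\<close>, of "\<lambda>i. lehmer p i + i", OF this]
  show ?thesis by auto
qed

text \<open>A flat step at \<open>a\<close> is an ascent of \<open>p\<close>, and a cliff at
  \<open>b\<close> leaves a later entry between \<open>p ! Suc b\<close> and \<open>p ! b\<close>;
  these supply the 34 and the 12. Conversely, the 34 forces a flat step, and crossing the value of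
  the 2 on the way down forces a cliff.\<close>

lemma avoids_3412_iff_lehmer:
  assumes "distinct p" "avoids p [1, 3, 2]"
  shows "avoids p [3, 4, 1, 2] \<longleftrightarrow> \<not> flat_before_cliff (lehmer p)"
proof
  assume av: "avoids p [3, 4, 1, 2]"
  show "\<not> flat_before_cliff (lehmer p)"
  proof
    assume "flat_before_cliff (lehmer p)"
    then obtain a b where ab: "a < b" "lehmer p a \<le> lehmer p (Suc a)"
      "lehmer p (Suc b) + 2 \<le> lehmer p b"
      unfolding flat_before_cliff_def by blast
    \<comment> \<open>Codes are 0 beyond the list, so a positive entry shows that the cliff lies
      inside it.\<close>
    have "lehmer p b \<noteq> 0" using ab by linarith
    then have "{j. b < j \<and> j < length p \<and> p ! j < p ! b} \<noteq> {}"
      unfolding lehmer_def by (metis card.empty)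
    then have b: "Suc b < length p" by auto
    have asc: "p ! a < p ! Suc a"
    proof (rule ccontr)
      assume "\<not> p ! a < p ! Suc a"
      moreover have "p ! a \<noteq> p ! Suc a"
        using assms ab b by (simp add: nth_eq_iff_index_eq)
      ultimately have less: "p ! Suc a < p ! a" by simp
      have "lehmer p (Suc a) < lehmer p a"
        unfolding lehmer_def
      proof (rule psubset_card_mono)
        have "Suc a \<in> {j. a < j \<and> j < length p \<and> p ! j < p ! a}"
          using less ab b by auto
        then show "{j. Suc a < j \<and> j < length p \<and> p ! j < p ! Suc a} \<subset>
            {j. a < j \<and> j < length p \<and> p ! j < p ! a}"
          using less by fastforce
      qed auto
      with ab show False by simp
    qed
    \<comment> \<open>Otherwise \<open>b\<close> would count at most \<open>Suc b\<close> itself and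
      what \<open>Suc b\<close> counts, a drop of at most one.\<close>
    have "\<exists>v. Suc b < v \<and> v < length p \<and> p ! Suc b < p ! v \<and> p ! v < p ! b"
    proof (rule ccontr)
      assume no: "\<nexists>v. Suc b < v \<and> v < length p \<and> p ! Suc b < p ! v \<and> p ! v < p ! b"
      have "{j. b < j \<and> j < length p \<and> p ! j < p ! b} \<subseteq>
        insert (Suc b) {j. Suc b < j \<and> j < length p \<and> p ! j < p ! Suc b}"
      proof
        fix j assume j: "j \<in> {j. b < j \<and> j < length p \<and> p ! j < p ! b}"
        show "j \<in> insert (Suc b) {j. Suc b < j \<and> j < length p \<and> p ! j < p ! Suc b}"
        proof (cases "j = Suc b")
          case False
          then have "p ! j \<noteq> p ! Suc b" using j b assms by (simp add: nth_eq_iff_index_eq)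
          moreover have "\<not> p ! Suc b < p ! j" using no j False by auto
          ultimately show ?thesis using j False by auto
        qed simp
      qed
      then have "lehmer p b \<le> card (insert (Suc b) {j. Suc b < j \<and> j < length p \<and> p ! j < p ! Suc b})"
        unfolding lehmer_def by (intro card_mono) auto
      also have "\<dots> \<le> Suc (lehmer p (Suc b))"
        unfolding lehmer_def by (rule card_insert_le_m1) auto
      finally show False using ab by simp
    qed
    then obtain v where v: "Suc b < v" "v < length p" "p ! Suc b < p ! v" "p ! v < p ! b" by blast
    \<comment> \<open>If not, positions \<open>a\<close>, \<open>b\<close>, \<open>v\<close> would
      form a 132.\<close>
    have "p ! v < p ! a"
    proof (rule ccontr)
      assume "\<not> p ! v < p ! a"
      moreover have "p ! v \<noteq> p ! a"
        using assms ab v by (simp add: nth_eq_iff_index_eq)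
      ultimately have "p ! a < p ! v" by simp
      then have "a < b \<and> b < v \<and> v < length p \<and> p ! a < p ! v \<and> p ! v < p ! b"
        using ab v by auto
      with assms(2) show False unfolding avoids_132_iff by blast
    qed
    then have "a < Suc a \<and> Suc a < Suc b \<and> Suc b < v \<and> v < length p \<and>
      p ! Suc b < p ! v \<and> p ! v < p ! a \<and> p ! a < p ! Suc a"
      using v ab asc by auto
    with av show False unfolding avoids_3412_iff by blast
  qed
next
  assume no: "\<not> flat_before_cliff (lehmer p)"
  show "avoids p [3, 4, 1, 2]"
  proof (rule ccontr)
    assume "\<not> avoids p [3, 4, 1, 2]"
    then obtain x y u v where xyuv: "x < y" "y < u" "u < v" "v < length p"
      "p ! u < p ! v" "p ! v < p ! x" "p ! x < p ! y"
      unfolding avoids_3412_iff by blast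
    then obtain a where a: "a < y" "lehmer p a \<le> lehmer p (Suc a)"
      using lehmer_flat[OF assms, of x y] by auto
    obtain b where b: "y \<le> b" "b < u" "p ! v < p ! b" "p ! Suc b < p ! v"
    proof -
      \<comment> \<open>The threshold is now the value playing the 2; the falling step gives
        adjacent entries on either side of it.\<close>
      define f where "f i = (if p ! i < p ! v then 0 else 1 :: nat)" for i
      have "f u < f y" using xyuv by (auto simp: f_def)
      from ex_step_down[OF \<open>y < u\<close> this]
      obtain b where b: "y \<le> b" "b < u" "\<not> p ! b < p ! v" "p ! Suc b < p ! v"
        by (auto simp: f_def split: if_splits)
      moreover have "p ! b \<noteq> p ! v"
        using assms b xyuv by (simp add: nth_eq_iff_index_eq)
      ultimately show ?thesis by (intro that[of b]) auto
    qed
    \<comment> \<open>Position \<open>b\<close> counts all that \<open>Suc b\<close> counts and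
      additionally \<open>Suc b\<close> and \<open>v\<close>, which makes the drop at least
      two.\<close>
    have "insert v (insert (Suc b) {j. Suc b < j \<and> j < length p \<and> p ! j < p ! Suc b})
      \<subseteq> {j. b < j \<and> j < length p \<and> p ! j < p ! b}"
      using b xyuv by auto
    then have "card (insert v (insert (Suc b) {j. Suc b < j \<and> j < length p \<and> p ! j < p ! Suc b}))
      \<le> lehmer p b"
      unfolding lehmer_def by (intro card_mono) auto
    moreover have "card (insert v (insert (Suc b) {j. Suc b < j \<and> j < length p \<and> p ! j < p ! Suc b}))
      = lehmer p (Suc b) + 2"
    proof -
      have "v \<noteq> Suc b" using b xyuv by simp
      then show ?thesis unfolding lehmer_def using b by simp
    qed
    ultimately have "flat_before_cliff (lehmer p)"
      unfolding flat_before_cliff_def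
      using a b by (intro exI[of _ a] exI[of _ b]) auto
    with no show False by simp
  qed
qed

text \<open>The common image of both bijections, with permutations and with convex arrangements. The
  truncated bound forces \<open>c i = 0\<close> from \<open>i = n - 1\<close> on, so
  \<open>c\<close> is determined by finitely many entries.\<close>

definition codes :: "nat \<Rightarrow> nat \<Rightarrow> (nat \<Rightarrow> nat) set" where
  "codes n k = {c. (\<forall>i. c i \<le> n - 1 - i) \<and> (\<forall>i. c (Suc i) \<le> c i) \<and>
     \<not> flat_before_cliff c \<and> (\<Sum>i<n. c i) = k}"

lemma card_avoiders_132_3412:
  "card {p \<in> permutations_of_set {1..n}. card (inversions p) = k \<and>
     avoids p [1, 3, 2] \<and> avoids p [3, 4, 1, 2]} = card (codes n k)"
proof (rule bij_betw_same_card[of lehmer], rule bij_betw_imageI)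
  let ?S = "{p \<in> permutations_of_set {1..n}. card (inversions p) = k \<and>
     avoids p [1, 3, 2] \<and> avoids p [3, 4, 1, 2]}"
  show "inj_on lehmer ?S"
    by (rule inj_on_subset[OF inj_on_lehmer[of "{1..n}"]]) auto
  have mem: "lehmer p \<in> codes n k \<longleftrightarrow> p \<in> ?S" if "p \<in> permutations_of_set {1..n}" for p
  proof -
    have len: "length p = n" and dist: "distinct p"
      using that by (auto simp: permutations_of_set_def distinct_card[symmetric])
    have "\<forall>i. lehmer p i \<le> n - 1 - i" using lehmer_le[of p] len by blast
    then show ?thesis
      using that avoids_132_iff_lehmer[OF dist] avoids_3412_iff_lehmer[OF dist]
      unfolding codes_def card_inversions mem_Collect_eq len by blast
  qed
  show "lehmer ` ?S = codes n k"
  proof (intro equalityI subsetI)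
    fix c assume c: "c \<in> codes n k"
    then obtain p where "p \<in> permutations_of_set {1..n}" "lehmer p = c"
      using lehmer_surj[of "{1..n}" c] by (auto simp: codes_def)
    with mem c show "c \<in> lehmer ` ?S" by blast
  qed (use mem in auto)
qed

section \<open>Penny arrangements\<close>

lemma sum_staircase: "(\<Sum>i<n. n - i) = n * (n + 1) div (2::nat)"
proof -
  have "(\<Sum>i<n. n - i) = (\<Sum>i<n. Suc i)"
    using sum.nat_diff_reindex[of "\<lambda>i. n - i" n]
    by (subst sum.nat_diff_reindex[symmetric]) (auto intro!: sum.cong)
  also have "\<dots> = \<Sum>{0..n}"
    by (induction n) (simp_all add: atLeast0AtMost)
  finally show ?thesis by (simp add: gauss_sum_nat)
qed

lemma interval_if_no_gap:
  fixes S :: "nat set"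
  assumes "finite S" "\<And>x y z. x \<in> S \<Longrightarrow> z \<in> S \<Longrightarrow> x < y \<Longrightarrow> y < z \<Longrightarrow> y \<in> S"
  shows "\<exists>a b. S = {a..b}"
proof (cases "S = {}")
  case True
  then show ?thesis by (intro exI[of _ 1] exI[of _ 0]) auto
next
  case False
  have "y \<in> S" if "Min S \<le> y" "y \<le> Max S" for y
    using that assms(2)[of "Min S" "Max S" y] Min_in[OF assms(1) False] Max_in[OF assms(1) False]
    by (cases "y = Min S"; cases "y = Max S") auto
  then have "{Min S..Max S} \<subseteq> S" by (meson atLeastAtMost_iff subsetI)
  moreover have "S \<subseteq> {Min S..Max S}" using assms(1) by auto
  ultimately have "S = {Min S..Max S}" by (rule equalityI[rotated])
  then show ?thesis by blast
qed

lemma downset_eq_lessThan: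
  fixes S :: "nat set"
  assumes "finite S" "\<And>x y. x \<in> S \<Longrightarrow> y \<le> x \<Longrightarrow> y \<in> S"
  shows "S = {..<card S}"
proof (cases "S = {}")
  case False
  have "{..Max S} \<subseteq> S" using assms(2)[OF Max_in[OF assms(1) False]] by blast
  moreover have "S \<subseteq> {..Max S}" using assms(1) by auto
  ultimately have S: "S = {..Max S}" by (rule equalityI[rotated])
  then have "card S = card {..Max S}" by (rule arg_cong)
  then have "card S = Suc (Max S)" by simp
  with S show ?thesis by (simp only: lessThan_Suc_atMost)
qed simp

text \<open>
  The missing pennies, read by diagonals from the apex of the triangle, form a Young diagram with
  row lengths \<open>c 0 \<ge> c 1 \<ge> \<dots>\<close>; position \<open>i + 1\<close> of row \<open>h\<close> is the cell of row \<open>i\<close> and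
  column \<open>r - 1 - h - i\<close>.
\<close>

definition pennies :: "nat \<Rightarrow> (nat \<Rightarrow> nat) \<Rightarrow> nat \<Rightarrow> nat set" where
  "pennies r c h = Suc ` {i. c i + i + h < r}"

lemma Suc_mem_pennies: "Suc i \<in> pennies r c h \<longleftrightarrow> c i + i + h < r"
  by (auto simp: pennies_def)

lemma pennies_subset: "pennies r c h \<subseteq> {1..r - h}"
  by (auto simp: pennies_def)

text \<open>The bound makes \<open>c i + i < r\<close> for \<open>i < r\<close>, which fills the
  bottom row. Monotonicity lets \<open>c i + i\<close> grow by at most one per step, which supplies
  the right-hand supporting penny.\<close>

lemma penny_arrangement_pennies:
  assumes "\<And>i. c i \<le> r - 1 - i" "\<And>i. c (Suc i) \<le> c i"
  shows "penny_arrangement r (pennies r c)"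
  unfolding penny_arrangement_def
proof (intro conjI allI impI)
  show "pennies r c 0 = {1..r}"
  proof
    show "{1..r} \<subseteq> pennies r c 0"
    proof
      fix j assume "j \<in> {1..r}"
      then obtain i where [simp]: "j = Suc i" and "i < r" by (cases j) auto
      then show "j \<in> pennies r c 0" using assms(1)[of i] by (simp add: Suc_mem_pennies)
    qed
  qed (use pennies_subset[of r c 0] in simp)
  fix h j assume j: "j \<in> pennies r c (Suc h)"
  then obtain i where [simp]: "j = Suc i" by (auto simp: pennies_def)
  show "j \<in> pennies r c h" "j + 1 \<in> pennies r c h"
    using j assms(2)[of i] by (auto simp: Suc_mem_pennies)
qed (rule pennies_subset)

text \<open>Up to the shift by \<open>Suc\<close>, row \<open>h\<close> is the set where
  \<open>c i + i\<close> lies below \<open>r - h\<close>. A gap in a row is a point at or above this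
  level between two points below it, that is, an ascent before a descent.\<close>

lemma convex_pennies_iff:
  assumes "\<And>i. c i \<le> r - 1 - i" "\<And>i. c (Suc i) \<le> c i"
  shows "convex_arrangement (pennies r c) \<longleftrightarrow> \<not> flat_before_cliff c"
proof
  assume conv: "convex_arrangement (pennies r c)"
  show "\<not> flat_before_cliff c"
  proof
    assume "flat_before_cliff c"
    then obtain a b where ab: "a < b" "c a \<le> c (Suc a)" "c (Suc b) + 2 \<le> c b"
      unfolding flat_before_cliff_def by blast
    \<comment> \<open>The lowest level reaching both \<open>a\<close> and \<open>Suc b\<close>. The
      row chosen below, \<open>r - (m + 1)\<close>, keeps exactly the indices whose code plus index
      is at most \<open>m\<close>.\<close>
    define m where "m = max (c a + a) (c (Suc b) + Suc b)"
    \<comment> \<open>The larger of the two end values decides: either the ascent out of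
      \<open>a\<close> or the descent into \<open>Suc b\<close> provides a point above it.\<close>
    have "\<exists>y. a < y \<and> y \<le> b \<and> m < c y + y"
    proof (cases "m = c a + a")
      case True
      then show ?thesis using ab by (intro exI[of _ "Suc a"]) auto
    next
      case False
      then have "m = c (Suc b) + Suc b" by (auto simp: m_def)
      then show ?thesis using ab by (intro exI[of _ b]) auto
    qed
    then obtain y where y: "a < y" "y \<le> b" "m < c y + y" by blast
    \<comment> \<open>A cliff has \<open>c b\<close> at least 2, so \<open>c y\<close> is positive
      and its bound is not truncated; this makes \<open>r - (m + 1)\<close> an honest
      subtraction.\<close>
    have "c b \<le> c y" using y(2) assms(2) by (rule lift_Suc_antimono_le[rotated])
    then have mr: "m + 1 < r" using y ab assms(1)[of y] by linarith
    have "Suc a \<in> pennies r c (r - (m + 1))" "Suc (Suc b) \<in> pennies r c (r - (m + 1))"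
      "Suc y \<notin> pennies r c (r - (m + 1))"
      using mr y by (auto simp: Suc_mem_pennies m_def)
    moreover obtain l u where "pennies r c (r - (m + 1)) = {l..u}"
      using conv unfolding convex_arrangement_def by blast
    ultimately show False using y by auto
  qed
next
  assume no: "\<not> flat_before_cliff c"
  show "convex_arrangement (pennies r c)"
    unfolding convex_arrangement_def
  proof
    fix h
    have "y \<in> pennies r c h" if xz: "x \<in> pennies r c h" "z \<in> pennies r c h" "x < y" "y < z" for x y z
    proof (rule ccontr)
      assume y: "y \<notin> pennies r c h"
      obtain x' y' z' where [simp]: "x = Suc x'" "y = Suc y'" "z = Suc z'"
        using xz pennies_subset[of r c h] by (cases x; cases y; cases z) auto
      define f where "f i = c i + i" for i
      have "x' < y'" "f x' < f y'" "y' < z'" "f z' < f y'"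
        using xz y by (auto simp: Suc_mem_pennies f_def)
      then obtain a b where "a < y'" "f a < f (Suc a)" "y' \<le> b" "f (Suc b) < f b"
        using ex_step_up[of x' y' f] ex_step_down[of y' z' f] by blast
      then have "flat_before_cliff c"
        unfolding flat_before_cliff_def
        by (intro exI[of _ a] exI[of _ b]) (auto simp: f_def)
      with no show False by simp
    qed
    then show "\<exists>a b. pennies r c h = {a..b}"
      by (rule interval_if_no_gap[OF finite_subset[OF pennies_subset finite_atLeastAtMost]])
  qed
qed

text \<open>Double counting by position instead of by row: for \<open>i < r\<close>, position
  \<open>Suc i\<close> is occupied in exactly the rows below \<open>r - i - c i\<close>, which is
  \<open>c i\<close> fewer than in the full triangle.\<close>

lemma card_pennies:
  assumes "\<And>i. c i \<le> r - 1 - i"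
  shows "(\<Sum>h<r. card (pennies r c h)) + (\<Sum>i<r. c i) = r * (r + 1) div 2"
proof -
  have "card (pennies r c h) = (\<Sum>i<r. of_bool (c i + i + h < r))" for h
  proof -
    have "card (pennies r c h) = card {i. c i + i + h < r}"
      by (simp add: pennies_def card_image)
    also have "{i. c i + i + h < r} = {..<r} \<inter> {i. c i + i + h < r}" by auto
    finally show ?thesis by simp
  qed
  then have "(\<Sum>h<r. card (pennies r c h)) = (\<Sum>h<r. \<Sum>i<r. of_bool (c i + i + h < r))"
    by (simp only:)
  also have "\<dots> = (\<Sum>i<r. \<Sum>h<r. of_bool (c i + i + h < r))"
    by (rule sum.swap)
  also have "\<dots> = (\<Sum>i<r. r - i - c i)"
  proof (intro sum.cong refl)
    fix i
    have "{..<r} \<inter> {h. c i + i + h < r} = {..<r - i - c i}" by auto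
    then show "(\<Sum>h<r. of_bool (c i + i + h < r)) = r - i - c i" by simp
  qed
  finally have "(\<Sum>h<r. card (pennies r c h)) + (\<Sum>i<r. c i) = (\<Sum>i<r. r - i - c i + c i)"
    by (simp add: sum.distrib)
  also have "\<dots> = (\<Sum>i<r. r - i)"
  proof (intro sum.cong refl)
    fix i assume "i \<in> {..<r}"
    then show "r - i - c i + c i = r - i" using assms[of i] by auto
  qed
  finally show ?thesis by (simp add: sum_staircase)
qed

text \<open>Each position is occupied in an initial segment of rows, of height \<open>m i\<close>.
  The right-hand support gives \<open>m i \<le> Suc (m (Suc i))\<close>, so the deficits from the
  full height \<open>r - i\<close> weakly decrease; the full bottom row gives the bound on
  them.\<close>

lemma penny_arrangement_eq_pennies:
  assumes "penny_arrangement r P"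
  obtains c where "P = pennies r c" "\<And>i. c i \<le> r - 1 - i" "\<And>i. c (Suc i) \<le> c i"
proof -
  have sub: "P h \<subseteq> {1..r - h}" and bottom: "P 0 = {1..r}"
    and down: "j \<in> P (Suc h) \<Longrightarrow> j \<in> P h" "j \<in> P (Suc h) \<Longrightarrow> Suc j \<in> P h" for h j
    using assms unfolding penny_arrangement_def Suc_eq_plus1[symmetric] by blast+
  define m where "m i = card {h. Suc i \<in> P h}" for i
  have col: "Suc i \<in> P h \<longleftrightarrow> h < m i" for i h
  proof -
    have le: "j \<in> P h'" if "h' \<le> h" "j \<in> P h" for h h' j
      using that(1,2) by (induction rule: inc_induct) (use down(1) in blast)+
    have "finite {h. Suc i \<in> P h}"
    proof (rule finite_subset)
      show "{h. Suc i \<in> P h} \<subseteq> {..r}" using sub by fastforce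
    qed simp
    moreover have "h' \<in> {h. Suc i \<in> P h}" if "h \<in> {h. Suc i \<in> P h}" "h' \<le> h" for h h'
      using le that by blast
    ultimately have "{h. Suc i \<in> P h} = {..<m i}"
      unfolding m_def by (rule downset_eq_lessThan)
    then show ?thesis by auto
  qed
  have m_le: "m i \<le> r - i" for i
  proof (cases "m i")
    case (Suc k)
    then have "Suc i \<in> P k" by (simp add: col)
    then show ?thesis using sub[of k] Suc by auto
  qed simp
  have m_pos: "0 < m i" if "i < r" for i
    using that bottom by (simp flip: col)
  have m_Suc: "m i \<le> Suc (m (Suc i))" for i
  proof (cases "m i")
    case (Suc k)
    show ?thesis
    proof (cases k)
      case (Suc l)
      then have "Suc i \<in> P (Suc l)" using \<open>m i = Suc k\<close> by (simp add: col)
      then have "Suc (Suc i) \<in> P l" by (rule down)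
      then show ?thesis using Suc \<open>m i = Suc k\<close> by (simp add: col)
    qed (use Suc in simp)
  qed simp
  define c where "c i = r - i - m i" for i
  show ?thesis
  proof
    show "P = pennies r c"
    proof (intro ext set_eqI)
      fix h j
      show "j \<in> P h \<longleftrightarrow> j \<in> pennies r c h"
      proof (cases j)
        case 0
        then show ?thesis using sub[of h] pennies_subset[of r c h] by auto
      next
        case (Suc i)
        then show ?thesis
          using m_le[of i] by (auto simp: Suc_mem_pennies col c_def)
      qed
    qed
    show "c i \<le> r - 1 - i" for i
      using m_pos[of i] by (cases "i < r") (auto simp: c_def)
    show "c (Suc i) \<le> c i" for i
      using m_Suc[of i] m_le[of i] by (auto simp: c_def)
  qed
qed

lemma convex_penny_defect_count_eq:
  assumes "k \<le> r * (r + 1) div 2"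
  shows "convex_penny_defect_count k r = card (codes r k)"
proof -
  let ?T = "{P. penny_arrangement r P \<and> convex_arrangement P \<and>
    (\<Sum>h<r. card (P h)) = r * (r + 1) div 2 - k}"
  have "bij_betw (pennies r) (codes r k) ?T"
  proof (rule bij_betw_imageI)
    show "inj_on (pennies r) (codes r k)"
    proof (intro inj_onI ext)
      fix c d i assume cd: "c \<in> codes r k" "d \<in> codes r k" "pennies r c = pennies r d"
      have le: "c i \<le> r - 1 - i" "d i \<le> r - 1 - i" using cd by (auto simp: codes_def)
      have "c i + i + h < r \<longleftrightarrow> d i + i + h < r" for h
        using cd(3) by (simp flip: Suc_mem_pennies)
      \<comment> \<open>For \<open>i < r\<close> these are the topmost rows holding
        \<open>Suc i\<close> under \<open>c\<close> and under \<open>d\<close>; comparing them gives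
        both inequalities. For other \<open>i\<close> both codes are 0.\<close>
      from this[of "r - 1 - i - c i"] this[of "r - 1 - i - d i"] le
      show "c i = d i" by (cases "i < r") auto
    qed
    show "pennies r ` codes r k = ?T"
    proof (intro equalityI subsetI)
      fix P assume "P \<in> pennies r ` codes r k"
      then obtain c where [simp]: "P = pennies r c" and c: "c \<in> codes r k" by blast
      then have c': "\<And>i. c i \<le> r - 1 - i" "\<And>i. c (Suc i) \<le> c i" "\<not> flat_before_cliff c"
        "(\<Sum>i<r. c i) = k" by (auto simp: codes_def)
      have "(\<Sum>h<r. card (P h)) = r * (r + 1) div 2 - k"
        using card_pennies[of c r, OF c'(1)] unfolding c'(4) by simp
      then show "P \<in> ?T"
        using c' penny_arrangement_pennies[OF c'(1,2)] convex_pennies_iff[OF c'(1,2)] by simp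
    next
      fix P assume P: "P \<in> ?T"
      then obtain c where c: "P = pennies r c" "\<And>i. c i \<le> r - 1 - i" "\<And>i. c (Suc i) \<le> c i"
        by (auto elim: penny_arrangement_eq_pennies)
      have "(\<Sum>i<r. c i) = k"
        using card_pennies[of c r, OF c(2)] P c(1) assms by simp
      then have "c \<in> codes r k"
        using P c convex_pennies_iff[OF c(2,3)] by (simp add: codes_def)
      then show "P \<in> pennies r ` codes r k" using c(1) by blast
    qed
  qed
  then show ?thesis
    unfolding convex_penny_defect_count_def convex_penny_count_def
    by (simp add: bij_betw_same_card[symmetric])
qed

section \<open>Stabilisation of the set of codes\<close>

text \<open>If \<open>c i\<close> is positive, the \<open>i\<close> entries before it are positive
  too, so \<open>i + c i\<close> is at most the total \<open>k\<close>. The bound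
  \<open>c i \<le> k - i\<close>, which is the one for size \<open>Suc k\<close>, is therefore
  automatic and independent of \<open>n\<close>.\<close>

lemma codes_eq:
  assumes "k < n"
  shows "codes n k = codes (Suc k) k"
proof -
  have bound: "c i \<le> k - i"
    if dec: "\<And>i. c (Suc i) \<le> c i" and sum: "(\<Sum>i<m. c i) = k" and zero: "\<And>i. m \<le> i \<Longrightarrow> c i = 0"
    for c :: "nat \<Rightarrow> nat" and m i
  proof (cases "c i = 0")
    case False
    then have "i < m" using zero[of i] by (meson not_less)
    have "c i \<le> c j" if "j \<le> i" for j
      using that dec by (rule lift_Suc_antimono_le[rotated])
    then have "1 \<le> c j" if "j \<le> i" for j
      using that False by fastforce
    then have "(\<Sum>j<i. 1) \<le> (\<Sum>j<i. c j)" by (intro sum_mono) auto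
    then have "i + c i \<le> (\<Sum>j<Suc i. c j)" by simp
    also have "\<dots> \<le> (\<Sum>j<m. c j)" using \<open>i < m\<close> by (intro sum_mono2) auto
    finally show ?thesis using sum by simp
  qed simp
  have sum_eq: "(\<Sum>i<n. c i) = (\<Sum>i<Suc k. c i)" if "\<And>i. c i \<le> k - i" for c :: "nat \<Rightarrow> nat"
  proof (rule sum.mono_neutral_right)
    show "\<forall>i\<in>{..<n} - {..<Suc k}. c i = 0"
    proof
      fix i assume "i \<in> {..<n} - {..<Suc k}"
      then show "c i = 0" using that[of i] by simp
    qed
  qed (use assms in auto)
  show ?thesis
  proof (intro equalityI subsetI)
    fix c assume c: "c \<in> codes n k"
    have "c i = 0" if "n \<le> i" for i
    proof -
      have "c i \<le> n - 1 - i" using c by (simp add: codes_def)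
      then show ?thesis using that by simp
    qed
    then have "c i \<le> k - i" for i
      using c by (intro bound[of c n]) (auto simp: codes_def)
    then show "c \<in> codes (Suc k) k"
      using c sum_eq[of c] by (simp add: codes_def)
  next
    fix c assume c: "c \<in> codes (Suc k) k"
    then have le: "c i \<le> k - i" for i by (simp add: codes_def)
    then have "c i \<le> n - 1 - i" for i using assms le[of i] by linarith
    then show "c \<in> codes n k"
      using c sum_eq[of c] le by (simp add: codes_def)
  qed
qed

section \<open>Reverse complements and direct sums\<close>

lemma permutations_of_set_atLeastAtMost_length:
  assumes "p \<in> permutations_of_set {1..n}"
  shows "length p = n"
  using assms by (auto simp: permutations_of_set_def distinct_card[symmetric])

definition reverse_complement :: "nat \<Rightarrow> nat list \<Rightarrow> nat list" where
  "reverse_complement n p = rev (map (\<lambda>x. Suc n - x) p)"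

lemma reverse_complement_in_permutations:
  assumes "p \<in> permutations_of_set {1..n}"
  shows "reverse_complement n p \<in> permutations_of_set {1..n}"
proof -
  have p: "set p = {1..n}" "distinct p" using assms by (auto simp: permutations_of_set_def)
  have "(\<lambda>x. Suc n - x) ` {1..n} = {1..n}"
  proof (intro equalityI subsetI)
    fix x assume "x \<in> {1..n}"
    then show "x \<in> (\<lambda>x. Suc n - x) ` {1..n}" by (intro image_eqI[of _ _ "Suc n - x"]) auto
  qed auto
  moreover have "inj_on (\<lambda>x. Suc n - x) {1..n}" by (auto simp: inj_on_def)
  ultimately show ?thesis
    using p by (simp add: reverse_complement_def permutations_of_set_def distinct_map)
qed

lemma reverse_complement_involution:
  assumes "p \<in> permutations_of_set {1..n}"
  shows "reverse_complement n (reverse_complement n p) = p"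
proof -
  have "set p = {1..n}" using assms by (auto simp: permutations_of_set_def)
  then show ?thesis
    unfolding reverse_complement_def rev_map rev_rev_ident map_map
    by (intro map_idI) auto
qed

lemma nth_reverse_complement_less_iff:
  assumes "p \<in> permutations_of_set {1..n}" "i < n" "j < n"
  shows "reverse_complement n p ! i < reverse_complement n p ! j \<longleftrightarrow>
    p ! (n - 1 - j) < p ! (n - 1 - i)"
proof -
  have len: "length p = n" using assms(1) by (rule permutations_of_set_atLeastAtMost_length)
  have "p ! (n - 1 - j) \<in> set p" "p ! (n - 1 - i) \<in> set p"
    using assms len by (auto intro!: nth_mem)
  then have "p ! (n - 1 - j) \<le> n" "p ! (n - 1 - i) \<le> n"
    using assms(1) by (auto simp: permutations_of_set_def)
  then show ?thesis
    using assms len by (auto simp: reverse_complement_def rev_nth)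
qed

text \<open>Reflecting positions maps inversions injectively to inversions; the opposite inequality
  is the same one applied to the image, by involutivity.\<close>

lemma card_inversions_reverse_complement:
  assumes "p \<in> permutations_of_set {1..n}"
  shows "card (inversions (reverse_complement n p)) = card (inversions p)"
proof -
  have le: "card (inversions (reverse_complement n p)) \<le> card (inversions p)"
    if p: "p \<in> permutations_of_set {1..n}" for p
  proof (rule card_inj_on_le)
    let ?f = "\<lambda>(i, j). (n - 1 - j, n - 1 - i)"
    have len: "length p = n" "length (reverse_complement n p) = n"
      using p reverse_complement_in_permutations permutations_of_set_atLeastAtMost_length by auto
    show "inj_on ?f (inversions (reverse_complement n p))"
      using len by (auto simp: inj_on_def inversions_def)
    show "?f ` inversions (reverse_complement n p) \<subseteq> inversions p"
      using len nth_reverse_complement_less_iff[OF p] by (auto simp: inversions_def)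
    have "inversions p \<subseteq> {..<n} \<times> {..<n}" using len by (auto simp: inversions_def)
    then show "finite (inversions p)" by (rule finite_subset) simp
  qed
  show ?thesis
    using le[OF assms] le[OF reverse_complement_in_permutations[OF assms]]
    by (simp add: reverse_complement_involution[OF assms])
qed

text \<open>The symmetry swaps 132 with 213 and fixes 3412. Implications suffice, since the map is
  an involution.\<close>

lemma avoids_reverse_complement:
  assumes p: "p \<in> permutations_of_set {1..n}"
  shows "avoids p [2, 1, 3] \<Longrightarrow> avoids (reverse_complement n p) [1, 3, 2]"
    and "avoids p [1, 3, 2] \<Longrightarrow> avoids (reverse_complement n p) [2, 1, 3]"
    and "avoids p [3, 4, 1, 2] \<Longrightarrow> avoids (reverse_complement n p) [3, 4, 1, 2]"
proof -
  let ?q = "reverse_complement n p"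
  have len: "length p = n" "length ?q = n"
    using p reverse_complement_in_permutations permutations_of_set_atLeastAtMost_length by auto
  note less_iff = nth_reverse_complement_less_iff[OF p]
  show "avoids ?q [1, 3, 2]" if "avoids p [2, 1, 3]"
    unfolding avoids_132_iff
  proof clarify
    fix a b c assume "a < b" "b < c" "c < length ?q" "?q ! a < ?q ! c" "?q ! c < ?q ! b"
    then have "n - 1 - c < n - 1 - b \<and> n - 1 - b < n - 1 - a \<and> n - 1 - a < length p \<and>
      p ! (n - 1 - b) < p ! (n - 1 - c) \<and> p ! (n - 1 - c) < p ! (n - 1 - a)"
      using len by (auto simp: less_iff)
    with that show False unfolding avoids_213_iff by blast
  qed
  show "avoids ?q [2, 1, 3]" if "avoids p [1, 3, 2]"
    unfolding avoids_213_iff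
  proof clarify
    fix a b c assume "a < b" "b < c" "c < length ?q" "?q ! b < ?q ! a" "?q ! a < ?q ! c"
    then have "n - 1 - c < n - 1 - b \<and> n - 1 - b < n - 1 - a \<and> n - 1 - a < length p \<and>
      p ! (n - 1 - c) < p ! (n - 1 - a) \<and> p ! (n - 1 - a) < p ! (n - 1 - b)"
      using len by (auto simp: less_iff)
    with that show False unfolding avoids_132_iff by blast
  qed
  show "avoids ?q [3, 4, 1, 2]" if "avoids p [3, 4, 1, 2]"
    unfolding avoids_3412_iff
  proof clarify
    fix a b c d assume "a < b" "b < c" "c < d" "d < length ?q"
      "?q ! c < ?q ! d" "?q ! d < ?q ! a" "?q ! a < ?q ! b"
    then have "n - 1 - d < n - 1 - c \<and> n - 1 - c < n - 1 - b \<and> n - 1 - b < n - 1 - a \<and>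
      n - 1 - a < length p \<and> p ! (n - 1 - b) < p ! (n - 1 - a) \<and>
      p ! (n - 1 - a) < p ! (n - 1 - d) \<and> p ! (n - 1 - d) < p ! (n - 1 - c)"
      using len by (auto simp: less_iff)
    with that show False unfolding avoids_3412_iff by blast
  qed
qed

lemma card_avoiders_213_3412:
  "card {p \<in> permutations_of_set {1..n}. card (inversions p) = k \<and>
     avoids p [2, 1, 3] \<and> avoids p [3, 4, 1, 2]} = card (codes n k)"
proof -
  let ?A = "{p \<in> permutations_of_set {1..n}. card (inversions p) = k \<and>
     avoids p [1, 3, 2] \<and> avoids p [3, 4, 1, 2]}"
  let ?B = "{p \<in> permutations_of_set {1..n}. card (inversions p) = k \<and>
     avoids p [2, 1, 3] \<and> avoids p [3, 4, 1, 2]}"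
  have "bij_betw (reverse_complement n) ?B ?A"
  proof (rule bij_betw_byWitness[where f' = "reverse_complement n"])
    show "reverse_complement n ` ?B \<subseteq> ?A" "reverse_complement n ` ?A \<subseteq> ?B"
      using reverse_complement_in_permutations card_inversions_reverse_complement
        avoids_reverse_complement by (blast intro: trans)+
  qed (use reverse_complement_involution in blast)+
  then show ?thesis
    by (simp only: bij_betw_same_card card_avoiders_132_3412)
qed

section \<open>Direct sums and the patterns they avoid\<close>

definition direct_sum :: "nat list \<Rightarrow> nat list \<Rightarrow> nat list" where
  "direct_sum p q = p @ map (\<lambda>x. x + length p) q"

lemma length_direct_sum: "length (direct_sum p q) = length p + length q"
  by (simp add: direct_sum_def)

lemma nth_direct_sum:
  "i < length p \<Longrightarrow> direct_sum p q ! i = p ! i"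
  "i < length q \<Longrightarrow> direct_sum p q ! (length p + i) = q ! i + length p"
  by (simp_all add: direct_sum_def nth_append)

lemma direct_sum_in_permutations:
  assumes "p \<in> permutations_of_set {1..m}" "q \<in> permutations_of_set {1..l}"
  shows "direct_sum p q \<in> permutations_of_set {1..m + l}"
proof -
  have len: "length p = m" using assms(1) by (rule permutations_of_set_atLeastAtMost_length)
  have pq: "set p = {1..m}" "distinct p" "set q = {1..l}" "distinct q"
    using assms by (auto simp: permutations_of_set_def)
  have "(\<lambda>x. x + m) ` {1..l} = {1 + m..l + m}" by (rule image_add_atLeastAtMost')
  then have "set (direct_sum p q) = {1..m + l}"
    using pq len by (auto simp: direct_sum_def)
  moreover have "distinct (direct_sum p q)"
    using pq len by (auto simp: direct_sum_def distinct_map inj_on_def)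
  ultimately show ?thesis by (simp add: permutations_of_set_def)
qed

text \<open>All entries of the left block are at most \<open>length p\<close> and all shifted
  entries exceed it, so no inversion crosses the cut.\<close>

lemma card_inversions_direct_sum:
  assumes "set p \<subseteq> {1..length p}" "0 \<notin> set q"
  shows "card (inversions (direct_sum p q)) = card (inversions p) + card (inversions q)"
proof -
  let ?m = "length p"
  let ?s = "\<lambda>(i, j). (?m + i, ?m + j)"
  have p_le: "p ! i \<le> ?m" if "i < ?m" for i
    using assms(1) nth_mem[OF that] by auto
  have q_pos: "0 < q ! i" if "i < length q" for i
    using assms(2) nth_mem[OF that] by (metis gr0I)
  have "inversions (direct_sum p q) = inversions p \<union> ?s ` inversions q"
  proof (intro equalityI subsetI)
    fix x assume "x \<in> inversions (direct_sum p q)"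
    then obtain i j where x: "x = (i, j)" "i < j" "j < ?m + length q"
      "direct_sum p q ! j < direct_sum p q ! i"
      by (auto simp: inversions_def length_direct_sum)
    show "x \<in> inversions p \<union> ?s ` inversions q"
    proof (cases "j < ?m")
      case True
      then show ?thesis using x by (simp add: nth_direct_sum inversions_def)
    next
      case False
      then obtain j' where j': "j = ?m + j'" "j' < length q"
        using x by (metis add_less_cancel_left le_Suc_ex not_less)
      have "\<not> i < ?m"
        using x j' p_le[of i] q_pos[of j'] by (auto simp: nth_direct_sum)
      then obtain i' where i': "i = ?m + i'"
        by (metis le_Suc_ex not_less)
      then have "(i', j') \<in> inversions q"
        using x j' by (simp add: inversions_def nth_direct_sum)
      then show ?thesis using x i' j' by force
    qed
  qed (auto simp: inversions_def nth_direct_sum length_direct_sum)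
  moreover have "inversions p \<inter> ?s ` inversions q = {}"
    by (auto simp: inversions_def)
  moreover have "inversions p \<subseteq> {..<?m} \<times> {..<?m}"
    "inversions q \<subseteq> {..<length q} \<times> {..<length q}"
    by (auto simp: inversions_def)
  then have "finite (inversions p)" "finite (inversions q)"
    by (meson finite_SigmaI finite_lessThan finite_subset)+
  moreover have "inj_on ?s (inversions q)" by (auto simp: inj_on_def)
  ultimately show ?thesis by (simp add: card_Un_disjoint card_image)
qed

lemma nth_direct_sum_cases:
  assumes "p \<in> permutations_of_set {1..m}" "q \<in> permutations_of_set {1..l}" "i < m + l"
  shows "i < m \<and> direct_sum p q ! i = p ! i \<and> p ! i \<le> m \<or>
    m \<le> i \<and> direct_sum p q ! i = q ! (i - m) + m \<and> 0 < q ! (i - m)"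
proof -
  have len: "length p = m" "length q = l"
    using assms permutations_of_set_atLeastAtMost_length by auto
  show ?thesis
  proof (cases "i < m")
    case True
    then have "p ! i \<in> {1..m}"
      using assms(1) len nth_mem[of i p] by (simp add: permutations_of_set_def)
    with True len show ?thesis by (simp add: nth_direct_sum)
  next
    case False
    then have "q ! (i - m) \<in> {1..l}"
      using assms len nth_mem[of "i - m" q] by (simp add: permutations_of_set_def)
    with False len assms(3) show ?thesis by (simp add: direct_sum_def nth_append)
  qed
qed

text \<open>Position \<open>m\<close> serves as the 4 above any 132 on the left, and position 0 as
  the 1 below any 213 on the right; hence both blocks must be nonempty. Conversely, the descent 32
  cannot cross the cut, so its block contains the 132 or the 213.\<close>

lemma avoids_1324_direct_sum_iff:
  assumes p: "p \<in> permutations_of_set {1..m}" and q: "q \<in> permutations_of_set {1..l}"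
    and pos: "0 < m" "0 < l"
  shows "avoids (direct_sum p q) [1, 3, 2, 4] \<longleftrightarrow> avoids p [1, 3, 2] \<and> avoids q [2, 1, 3]"
proof -
  let ?r = "direct_sum p q"
  have len: "length p = m" "length q = l" "length ?r = m + l"
    using p q permutations_of_set_atLeastAtMost_length by (auto simp: length_direct_sum)
  note cases = nth_direct_sum_cases[OF p q]
  have left: "?r ! i = p ! i" "p ! i \<le> m" "0 < p ! i" if "i < m" for i
  proof -
    have "p ! i \<in> {1..m}"
      using p len that nth_mem[of i p] by (simp add: permutations_of_set_def)
    then show "?r ! i = p ! i" "p ! i \<le> m" "0 < p ! i" using that len by (auto simp: nth_direct_sum)
  qed
  have right: "?r ! (m + i) = q ! i + m" "0 < q ! i" if "i < l" for i
    using cases[of "m + i"] that by auto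
  show ?thesis
  proof (intro iffI conjI)
    assume av: "avoids ?r [1, 3, 2, 4]"
    show "avoids p [1, 3, 2]"
      unfolding avoids_132_iff
    proof clarify
      fix a b c assume abc: "a < b" "b < c" "c < length p" "p ! a < p ! c" "p ! c < p ! b"
      then have "c < m" "m < length ?r" "?r ! a < ?r ! c" "?r ! c < ?r ! b" "?r ! b < ?r ! m"
        using left[of a] left[of b] left[of c] right[of 0] len pos by auto
      with av abc show False unfolding avoids_1324_iff by blast
    qed
    show "avoids q [2, 1, 3]"
      unfolding avoids_213_iff
    proof clarify
      fix a b c assume abc: "a < b" "b < c" "c < length q" "q ! b < q ! a" "q ! a < q ! c"
      then have "0 < m + a" "m + a < m + b" "m + b < m + c" "m + c < length ?r"
        "?r ! 0 < ?r ! (m + b)" "?r ! (m + b) < ?r ! (m + a)" "?r ! (m + a) < ?r ! (m + c)"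
        using right[of a] right[of b] right[of c] left[of 0] len pos by auto
      with av show False unfolding avoids_1324_iff by blast
    qed
  next
    assume av: "avoids p [1, 3, 2] \<and> avoids q [2, 1, 3]"
    show "avoids ?r [1, 3, 2, 4]"
      unfolding avoids_1324_iff
    proof clarify
      fix a b c d assume abcd: "a < b" "b < c" "c < d" "d < length ?r"
        "?r ! a < ?r ! c" "?r ! c < ?r ! b" "?r ! b < ?r ! d"
      show False
      proof (cases "c < m")
        case True
        then have "c < length p" "p ! a < p ! c" "p ! c < p ! b"
          using abcd left[of a] left[of b] left[of c] len by auto
        with abcd av show False unfolding avoids_132_iff by blast
      next
        case False
        then have "m \<le> b"
          using abcd len cases[of b] cases[of c] by auto
        then have "b - m < c - m" "c - m < d - m" "d - m < length q"
          "q ! (c - m) < q ! (b - m)" "q ! (b - m) < q ! (d - m)"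
          using abcd len cases[of b] cases[of c] cases[of d] by auto
        with av show False unfolding avoids_213_iff by blast
      qed
    qed
  qed
qed

text \<open>The first entry of a 3412 exceeds the last, so an occurrence cannot begin left of the
  cut and end right of it.\<close>

lemma avoids_3412_direct_sum_iff:
  assumes p: "p \<in> permutations_of_set {1..m}" and q: "q \<in> permutations_of_set {1..l}"
  shows "avoids (direct_sum p q) [3, 4, 1, 2] \<longleftrightarrow>
    avoids p [3, 4, 1, 2] \<and> avoids q [3, 4, 1, 2]"
proof -
  let ?r = "direct_sum p q"
  have len: "length p = m" "length q = l" "length ?r = m + l"
    using p q permutations_of_set_atLeastAtMost_length by (auto simp: length_direct_sum)
  note cases = nth_direct_sum_cases[OF p q]
  have left: "?r ! i = p ! i" if "i < m" for i
    using that len by (simp add: nth_direct_sum)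
  have right: "?r ! (m + i) = q ! i + m" if "i < l" for i
    using cases[of "m + i"] that by auto
  show ?thesis
  proof (intro iffI conjI)
    assume av: "avoids ?r [3, 4, 1, 2]"
    show "avoids p [3, 4, 1, 2]"
      unfolding avoids_3412_iff
    proof clarify
      fix a b c d assume abcd: "a < b" "b < c" "c < d" "d < length p"
        "p ! c < p ! d" "p ! d < p ! a" "p ! a < p ! b"
      then have "d < length ?r" "?r ! c < ?r ! d" "?r ! d < ?r ! a" "?r ! a < ?r ! b"
        using left[of a] left[of b] left[of c] left[of d] len by auto
      with av abcd show False unfolding avoids_3412_iff by blast
    qed
    show "avoids q [3, 4, 1, 2]"
      unfolding avoids_3412_iff
    proof clarify
      fix a b c d assume abcd: "a < b" "b < c" "c < d" "d < length q"
        "q ! c < q ! d" "q ! d < q ! a" "q ! a < q ! b"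
      then have "m + a < m + b" "m + b < m + c" "m + c < m + d" "m + d < length ?r"
        "?r ! (m + c) < ?r ! (m + d)" "?r ! (m + d) < ?r ! (m + a)" "?r ! (m + a) < ?r ! (m + b)"
        using right[of a] right[of b] right[of c] right[of d] len by auto
      with av show False unfolding avoids_3412_iff by blast
    qed
  next
    assume av: "avoids p [3, 4, 1, 2] \<and> avoids q [3, 4, 1, 2]"
    show "avoids ?r [3, 4, 1, 2]"
      unfolding avoids_3412_iff
    proof clarify
      fix a b c d assume abcd: "a < b" "b < c" "c < d" "d < length ?r"
        "?r ! c < ?r ! d" "?r ! d < ?r ! a" "?r ! a < ?r ! b"
      show False
      proof (cases "d < m")
        case True
        then have "d < length p" "p ! c < p ! d" "p ! d < p ! a" "p ! a < p ! b"
          using abcd left[of a] left[of b] left[of c] left[of d] len by auto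
        with abcd av show False unfolding avoids_3412_iff by blast
      next
        case False
        then have "m \<le> a"
          using abcd len cases[of a] cases[of d] by auto
        then have "a - m < b - m" "b - m < c - m" "c - m < d - m" "d - m < length q"
          using abcd len by linarith+
        moreover have
          "q ! (c - m) < q ! (d - m)" "q ! (d - m) < q ! (a - m)" "q ! (a - m) < q ! (b - m)"
          using abcd len \<open>m \<le> a\<close> cases[of a] cases[of b] cases[of c] cases[of d] by auto
        ultimately show False using av unfolding avoids_3412_iff by blast
      qed
    qed
  qed
qed

section \<open>Preserved prefixes\<close>

text \<open>Each of the \<open>p ! i - 1\<close> smaller values occurs at one of the
  \<open>i\<close> earlier positions or is counted by the code entry.\<close>

lemma nth_le_lehmer:
  assumes p: "p \<in> permutations_of_set {1..n}" and "i < n"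
  shows "p ! i \<le> i + 1 + lehmer p i"
proof -
  have len: "length p = n" using p by (rule permutations_of_set_atLeastAtMost_length)
  have pi: "p ! i \<in> {1..n}"
    using p \<open>i < n\<close> len nth_mem[of i p] by (simp add: permutations_of_set_def)
  let ?J = "{j. i < j \<and> j < length p \<and> p ! j < p ! i}"
  have "{1..<p ! i} \<subseteq> (!) p ` ({..<i} \<union> ?J)"
  proof
    fix v assume v: "v \<in> {1..<p ! i}"
    then have "v \<in> set p" using p pi by (auto simp: permutations_of_set_def)
    then obtain j where "j < length p" "v = p ! j" by (metis in_set_conv_nth)
    then show "v \<in> (!) p ` ({..<i} \<union> ?J)"
      using v by (cases i j rule: linorder_cases) auto
  qed
  then have "card {1..<p ! i} \<le> card ({..<i} \<union> ?J)"
    by (intro surj_card_le) auto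
  also have "\<dots> \<le> card {..<i} + card ?J" by (rule card_Un_le)
  finally show ?thesis by (simp add: lehmer_def)
qed

text \<open>
  If \<open>p\<close> does not preserve \<open>{1..t}\<close>, some entry \<open>p ! i > t\<close> occurs among the first \<open>t\<close>; since
  \<open>p ! i \<le> i + 1 + lehmer p i\<close>, the cut \<open>t\<close> lies in one of the intervals
  \<open>{i<..i + lehmer p i}\<close>, whose lengths add up to the number of inversions.
\<close>

lemma card_unpreserved_prefixes_le:
  assumes p: "p \<in> permutations_of_set {1..n}"
  shows "card {t \<in> {1..n}. set (take t p) \<noteq> {1..t}} \<le> card (inversions p)"
proof -
  have len: "length p = n" using p by (rule permutations_of_set_atLeastAtMost_length)
  have "{t \<in> {1..n}. set (take t p) \<noteq> {1..t}} \<subseteq> (\<Union>i<n. {i<..i + lehmer p i})"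
  proof
    fix t assume "t \<in> {t \<in> {1..n}. set (take t p) \<noteq> {1..t}}"
    then have t: "t \<le> n" "set (take t p) \<noteq> {1..t}" by auto
    have "\<not> set (take t p) \<subseteq> {1..t}"
    proof
      assume "set (take t p) \<subseteq> {1..t}"
      moreover have "card (set (take t p)) = t"
        using p t len by (simp add: distinct_card permutations_of_set_def)
      ultimately have "set (take t p) = {1..t}" by (intro card_subset_eq) auto
      with t show False by simp
    qed
    then obtain v where v: "v \<in> set (take t p)" "v \<notin> {1..t}" by blast
    then obtain i where i: "i < t" "v = p ! i"
      using v(1) t(1) len by (auto simp flip: nth_image)
    have "v \<in> set p" using v(1) by (rule in_set_takeD)
    then have "v \<in> {1..n}" using p by (simp add: permutations_of_set_def)
    then have "t < p ! i" using v(2) i by auto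
    also have "\<dots> \<le> i + 1 + lehmer p i" using i t(1) by (intro nth_le_lehmer[OF p]) linarith
    finally show "t \<in> (\<Union>i<n. {i<..i + lehmer p i})"
      using i t by (intro UN_I[of i]) auto
  qed
  then have "card {t \<in> {1..n}. set (take t p) \<noteq> {1..t}} \<le> card (\<Union>i<n. {i<..i + lehmer p i})"
    by (intro card_mono) auto
  also have "\<dots> \<le> (\<Sum>i<n. card {i<..i + lehmer p i})" by (rule card_UN_le) simp
  also have "\<dots> = card (inversions p)" using len by (simp add: card_inversions)
  finally show ?thesis .
qed

lemma ex_preserved_prefix:
  assumes "p \<in> permutations_of_set {1..n}" "T \<subseteq> {1..n}" "card (inversions p) < card T"
  shows "\<exists>t\<in>T. set (take t p) = {1..t}"
proof (rule ccontr)
  assume "\<not> (\<exists>t\<in>T. set (take t p) = {1..t})"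
  then have "T \<subseteq> {t \<in> {1..n}. set (take t p) \<noteq> {1..t}}" using assms(2) by blast
  then have "card T \<le> card {t \<in> {1..n}. set (take t p) \<noteq> {1..t}}" by (intro card_mono) auto
  with card_unpreserved_prefixes_le[OF assms(1)] assms(3) show False by simp
qed

text \<open>Few inversions force preserved prefixes of lengths \<open>s\<close> and \<open>t\<close>
  around \<open>m\<close>. If \<open>m\<close> is not preserved, a value above \<open>m\<close> sits
  before the cut and a value at most \<open>m\<close> after it; both lie between \<open>s\<close>
  and \<open>t\<close>, and positions 0 and \<open>t\<close> complete them to a 1324.\<close>

lemma preserves_prefix_if_avoids_1324:
  assumes p: "p \<in> permutations_of_set {1..n}" and av: "avoids p [1, 3, 2, 4]"
    and few: "card (inversions p) < m" "card (inversions p) < n - m"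
  shows "set (take m p) = {1..m}"
proof (rule ccontr)
  assume bad: "set (take m p) \<noteq> {1..m}"
  have len: "length p = n" using p by (rule permutations_of_set_atLeastAtMost_length)
  have sp: "set p = {1..n}" and dist: "distinct p"
    using p by (auto simp: permutations_of_set_def)
  have mn: "m < n" using few by linarith
  \<comment> \<open>Excluding 0 guarantees that position 0 lies in this prefix and can serve as the
    1.\<close>
  obtain s where s: "s \<in> {1..m}" "set (take s p) = {1..s}"
    using ex_preserved_prefix[OF p, of "{1..m}"] few mn by auto
  \<comment> \<open>Excluding \<open>n\<close> leaves an entry at position \<open>t\<close>, beyond
    the prefix, to serve as the 4.\<close>
  have "{m..<n} \<subseteq> {1..n}" using few by auto
  then obtain t where t: "t \<in> {m..<n}" "set (take t p) = {1..t}"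
    using ex_preserved_prefix[OF p, of "{m..<n}"] few by auto
  have st: "1 \<le> s" "s \<le> m" "m \<le> t" "t < n" using s t by auto
  have take_eq: "set (take u p) = (!) p ` {0..<u}" if "u \<le> n" for u
    using that len by (simp add: nth_image)
  have mem: "p ! i \<in> set (take u p) \<longleftrightarrow> i < u" if "i < n" "u \<le> n" for i u
    using that len dist by (auto simp: take_eq nth_eq_iff_index_eq)
  have pos: "1 \<le> p ! i" if "i < n" for i
    using that sp len nth_mem[of i p] by auto
  have at_s: "p ! i \<le> s \<longleftrightarrow> i < s" if "i < n" for i
    using mem[OF that, of s] st pos[OF that] unfolding s(2) by auto
  have at_t: "p ! i \<le> t \<longleftrightarrow> i < t" if "i < n" for i
    using mem[OF that, of t] st pos[OF that] unfolding t(2) by auto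
  have card_m: "card (set (take m p)) = card {1..m}"
    using dist len mn by (simp add: distinct_card)
  have "\<not> set (take m p) \<subseteq> {1..m}"
    using bad card_m by (metis card_subset_eq finite_atLeastAtMost)
  then obtain w where w: "w \<in> set (take m p)" "w \<notin> {1..m}" by blast
  then obtain i where "i < m" "w = p ! i" using mn by (auto simp: take_eq)
  then have i: "i < m" "m < p ! i" using w pos[of i] mn by auto
  have "\<not> {1..m} \<subseteq> set (take m p)"
    using bad card_m by (metis card_subset_eq List.finite_set)
  then obtain v where v: "v \<in> {1..m}" "v \<notin> set (take m p)" by blast
  then have "v \<in> set p" using sp mn by auto
  then obtain j where j: "j < n" "v = p ! j"
    using len by (metis in_set_conv_nth)
  have "m \<le> j" using v j mem[of j m] mn by auto
  have "s \<le> i" using at_s[of i] i st mn by linarith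
  moreover have "p ! 0 \<le> s" using at_s[of 0] st by linarith
  moreover have "s < p ! j" using at_s[of j] j st \<open>m \<le> j\<close> by linarith
  moreover have "p ! j \<le> m" using v j by simp
  moreover have "j < t" using at_t[of j] j st \<open>p ! j \<le> m\<close> by linarith
  moreover have "p ! i \<le> t" using at_t[of i] i st by linarith
  moreover have "t < p ! t" using at_t[of t] st by linarith
  ultimately have "0 < i" "i < j" "j < t" "t < length p"
    "p ! 0 < p ! j" "p ! j < p ! i" "p ! i < p ! t"
    using i st len \<open>m \<le> j\<close> by linarith+
  with av show False unfolding avoids_1324_iff by blast
qed

section \<open>Splitting long avoiders\<close>

lemma direct_sum_decomposition:
  assumes p: "p \<in> permutations_of_set {1..m + l}" and pre: "set (take m p) = {1..m}"
  obtains q r where "p = direct_sum q r" "q \<in> permutations_of_set {1..m}"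
    "r \<in> permutations_of_set {1..l}"
proof
  have len: "length p = m + l" using p by (rule permutations_of_set_atLeastAtMost_length)
  have sp: "set p = {1..m + l}" and dist: "distinct p"
    using p by (auto simp: permutations_of_set_def)
  let ?q = "take m p" and ?r = "map (\<lambda>x. x - m) (drop m p)"
  have "set (take m p) \<union> set (drop m p) = {1..m + l}"
    using sp by (metis append_take_drop_id set_append)
  moreover have "set (take m p) \<inter> set (drop m p) = {}"
    using dist by (rule set_take_disj_set_drop_if_distinct) simp
  ultimately have "set (drop m p) = {1..m + l} - {1..m}" using pre by blast
  also have "\<dots> = {m + 1..m + l}" by auto
  finally have sd: "set (drop m p) = {m + 1..m + l}" .
  show "p = direct_sum ?q ?r"
  proof -
    have "map ((\<lambda>x. x + m) \<circ> (\<lambda>x. x - m)) (drop m p) = drop m p"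
      using sd by (intro map_idI) auto
    then show ?thesis using len by (simp add: direct_sum_def)
  qed
  show "?q \<in> permutations_of_set {1..m}"
    using pre dist by (simp add: permutations_of_set_def)
  have "(\<lambda>x. x - m) ` {m + 1..m + l} = {1..l}"
  proof (intro equalityI subsetI)
    fix x assume "x \<in> {1..l}"
    then show "x \<in> (\<lambda>x. x - m) ` {m + 1..m + l}" by (intro image_eqI[of _ _ "x + m"]) auto
  qed auto
  moreover have "inj_on (\<lambda>x. x - m) {m + 1..m + l}" by (auto simp: inj_on_def)
  ultimately show "?r \<in> permutations_of_set {1..l}"
    using dist sd by (simp add: permutations_of_set_def distinct_map)
qed

text \<open>With \<open>k\<close> below both block sizes every avoider preserves the cut at
  \<open>m\<close>, so it is a direct sum in exactly one way with these sizes. Inversions add up,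
  which produces a convolution.\<close>

lemma av_1324_3412_eq:
  assumes "k < m" "k < l"
  shows "av (m + l) k {[1, 3, 2, 4], [3, 4, 1, 2]} =
    (\<Sum>i\<le>k. card (codes m i) * card (codes l (k - i)))"
proof -
  define A where "A i = {p \<in> permutations_of_set {1..m}. card (inversions p) = i \<and>
     avoids p [1, 3, 2] \<and> avoids p [3, 4, 1, 2]}" for i
  define B where "B j = {p \<in> permutations_of_set {1..l}. card (inversions p) = j \<and>
     avoids p [2, 1, 3] \<and> avoids p [3, 4, 1, 2]}" for j
  define S where "S = {p \<in> permutations_of_set {1..m + l}. card (inversions p) = k \<and>
     avoids p [1, 3, 2, 4] \<and> avoids p [3, 4, 1, 2]}"
  let ?T = "SIGMA i:{..k}. A i \<times> B (k - i)"
  let ?f = "\<lambda>(i, p, q). direct_sum p q"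
  have inv: "card (inversions (direct_sum p q)) = card (inversions p) + card (inversions q)"
    if "p \<in> permutations_of_set {1..m}" "q \<in> permutations_of_set {1..l}" for p q
  proof (rule card_inversions_direct_sum)
    show "set p \<subseteq> {1..length p}"
      using that(1) permutations_of_set_atLeastAtMost_length[OF that(1)]
      by (simp add: permutations_of_set_def)
    show "0 \<notin> set q" using that(2) by (simp add: permutations_of_set_def)
  qed
  have pos: "0 < m" "0 < l" using assms by auto
  have "bij_betw ?f ?T S"
  proof (rule bij_betw_imageI)
    show "inj_on ?f ?T"
    proof (rule inj_onI)
      fix x y assume xy: "x \<in> ?T" "y \<in> ?T" "?f x = ?f y"
      obtain i p q i' p' q' where [simp]: "x = (i, p, q)" "y = (i', p', q')"
        by (cases x; cases y) auto
      have *: "p \<in> A i" "p' \<in> A i'" "q \<in> B (k - i)" "q' \<in> B (k - i')"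
        and eq: "direct_sum p q = direct_sum p' q'"
        using xy by auto
      have "length p = length p'"
        using * permutations_of_set_atLeastAtMost_length[of _ m] by (simp add: A_def)
      moreover from this have "p = p'"
        using eq unfolding direct_sum_def by (metis append_eq_append_conv)
      moreover have "inj (\<lambda>x. x + length p')" by (simp add: inj_def)
      ultimately have "q = q'"
        using eq by (simp add: direct_sum_def inj_map_eq_map)
      moreover have "i = i'" using * \<open>p = p'\<close> by (simp add: A_def)
      ultimately show "x = y" using \<open>p = p'\<close> by simp
    qed
    show "?f ` ?T = S"
    proof (intro equalityI subsetI)
      fix x assume "x \<in> ?f ` ?T"
      then obtain i p q where ipq: "i \<le> k" "p \<in> A i" "q \<in> B (k - i)" "x = direct_sum p q" by auto
      then have pq: "p \<in> permutations_of_set {1..m}" "q \<in> permutations_of_set {1..l}"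
        by (simp_all add: A_def B_def)
      then show "x \<in> S"
        using ipq direct_sum_in_permutations[OF pq] inv[OF pq]
          avoids_1324_direct_sum_iff[OF pq pos] avoids_3412_direct_sum_iff[OF pq]
        by (simp add: A_def B_def S_def)
    next
      fix x assume x: "x \<in> S"
      then have perm: "x \<in> permutations_of_set {1..m + l}" by (simp add: S_def)
      have "set (take m x) = {1..m}"
        using x assms by (intro preserves_prefix_if_avoids_1324[OF perm]) (simp_all add: S_def)
      then obtain p q where x_eq: "x = direct_sum p q"
        and pq: "p \<in> permutations_of_set {1..m}" "q \<in> permutations_of_set {1..l}"
        using direct_sum_decomposition[OF perm] by blast
      \<comment> \<open>The index of the summand is recovered as the number of inversions of the
        left block.\<close>
      have "(card (inversions p), p, q) \<in> ?T"
        using x pq inv[OF pq] avoids_1324_direct_sum_iff[OF pq pos] avoids_3412_direct_sum_iff[OF pq]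
        by (auto simp: A_def B_def S_def x_eq)
      then show "x \<in> ?f ` ?T" using x_eq by (intro image_eqI) auto
    qed
  qed
  then have "card S = card ?T" by (simp add: bij_betw_same_card)
  also have "\<dots> = (\<Sum>i\<le>k. card (A i \<times> B (k - i)))"
    by (rule card_SigmaI) (auto simp: A_def B_def)
  also have "\<dots> = (\<Sum>i\<le>k. card (codes m i) * card (codes l (k - i)))"
    by (simp add: card_cartesian_product A_def B_def card_avoiders_132_3412[simplified]
        card_avoiders_213_3412[simplified])
  finally show ?thesis by (simp add: av_def S_def)
qed

section \<open>Limit sequences\<close>

lemma eventual_value_eqI:
  assumes "\<And>n. n \<ge> m \<Longrightarrow> f n = c"
  shows "eventual_value f = c"
  unfolding eventual_value_def
proof (rule the_equality)
  show "\<exists>m. \<forall>n\<ge>m. f n = c" using assms by blast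
  fix d assume "\<exists>m. \<forall>n\<ge>m. f n = d"
  then obtain m' where "\<forall>n\<ge>m'. f n = d" by blast
  then have "f (max m m') = d" by simp
  moreover have "f (max m m') = c" by (intro assms) simp
  ultimately show "d = c" by simp
qed

theorem proposition5p14:
  "has_limit_sequence {[1, 3, 2, 4], [3, 4, 1, 2]} \<and>
   (\<forall>k. eventually_constant (convex_penny_defect_count k)) \<and>
   limit_gf {[1, 3, 2, 4], [3, 4, 1, 2]} = (Abs_fps (\<lambda>k. int (A005576 k))) ^ 2"
proof -
  let ?B = "{[1, 3, 2, 4], [3, 4, 1, 2]} :: nat list set"
  define g where "g k = card (codes (Suc k) k)" for k
  have penny: "convex_penny_defect_count k r = g k" if "Suc k \<le> r" for k r
  proof -
    \<comment> \<open>This gives \<open>r \<le> r * (r + 1) div 2\<close>, so subtracting the defect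
      \<open>k\<close> is not truncated.\<close>
    have "r * 2 \<le> r * (r + 1)" using that by (intro mult_le_mono) auto
    then have "k \<le> r * (r + 1) div 2" using that by linarith
    then show ?thesis
      using that by (simp add: convex_penny_defect_count_eq codes_eq[of k r] g_def)
  qed
  then have A005576: "A005576 k = g k" for k
    unfolding A005576_def by (rule eventual_value_eqI)
  \<comment> \<open>The threshold lets the cut fall after \<open>Suc k\<close> positions with at
    least as many remaining, so that both blocks are in the stable range for every
    \<open>i \<le> k\<close>.\<close>
  have av: "av n k ?B = (\<Sum>i\<le>k. g i * g (k - i))" if "2 * Suc k \<le> n" for n k
  proof -
    have "av (Suc k + (n - Suc k)) k ?B =
        (\<Sum>i\<le>k. card (codes (Suc k) i) * card (codes (n - Suc k) (k - i)))"
      using that by (intro av_1324_3412_eq) auto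
    also have "\<dots> = (\<Sum>i\<le>k. g i * g (k - i))"
    proof (intro sum.cong refl)
      fix i assume "i \<in> {..k}"
      then show "card (codes (Suc k) i) * card (codes (n - Suc k) (k - i)) = g i * g (k - i)"
        using that codes_eq[of i "Suc k"] codes_eq[of "k - i" "n - Suc k"] by (simp add: g_def)
    qed
    finally show ?thesis using that by simp
  qed
  then have lim: "limit_sequence ?B k = (\<Sum>i\<le>k. g i * g (k - i))" for k
    unfolding limit_sequence_def by (rule eventual_value_eqI)
  have "has_limit_sequence ?B"
    unfolding has_limit_sequence_def eventually_constant_def using av by blast
  moreover have "\<forall>k. eventually_constant (convex_penny_defect_count k)"
    unfolding eventually_constant_def using penny by blast
  moreover have "limit_gf ?B = (Abs_fps (\<lambda>k. int (A005576 k))) ^ 2"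
    unfolding limit_gf_def lim A005576
    by (rule fps_ext) (simp add: power2_eq_square fps_mult_nth atLeast0AtMost)
  ultimately show ?thesis by blast
qed

end
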